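(* (i) The map $v\mapsto ?_V^{-1}(v)$ is a bijection from $A^*$ onto $\mathbb{Q}_1=\mathbb{Q}\cap(0,1)$; equivalently, the sequence $V_{10}$ contains every element of $\mathbb{Q}_1$ exactly once. (ii) The map $v\mapsto \hat{?}^{-1}(v)$ is a bijection from $A^*$ onto $\mathbb{Q}^+=\mathbb{Q}\cap(0,\infty)$; equivalently, the sequence $V_1$ contains every element of $\mathbb{Q}^+$ exactly once. (iii) The map $v\mapsto \hat{\hat{?}}^{-1}(v)$ is a bijection from $A^*$ onto $\mathbb{Q}$; equivalently, the sequence $V$ contains every element of $\mathbb{Q}$ exactly once.
   Context: Let $A=\{0,1\}$, $A^*$ the set of finite binary words (including the empty word $\varepsilon$), $A^\omega$ the infinite binary words, and for $w\in A^*$ let $\overline{w}$ denote its bitwise complement ($0\leftrightarrow 1$). Codes: for $b\in\mathbb{N}=\{1,2,\dots\}$ with binary expansion $b=\sum_{k=0}^{l}b_k2^k$, $l=\lfloor\log_2 b\rfloor$ (so $b_l=1$), set $C_I(b)=0^l\,1\,\overline{b_{l-1}}\,\overline{b_{l-2}}\cdots\overline{b_0}$ and $C_{II}(b)=\overline{C_I(b)}=1^l\,0\,b_{l-1}\cdots b_0$; also $C_I(\aleph_0)=0^\omega$, $C_{II}(\aleph_0)=1^\omega$. These are complete prefix-free codes. Continued fractions: every $p/q\in\mathbb{Q}_1$ has a unique finite continued fraction expansion $p/q=[b_1,b_2,\dots,b_{2l}]=\cfrac{1}{b_1+\cfrac{1}{b_2+\cdots}}$ with an even number of partial denominators $b_i\in\mathbb{N}$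 (using $[\dots,b_m]=[\dots,b_m-1,1]$ to adjust parity). $?_V^{-1}\colon A^*\to\mathbb{Q}_1$: for $v\in A^*$, decompose the infinite word $v\,1\,0^\omega$ (uniquely) as $C_I(b_1)\,C_{II}(b_2)\cdots C_I(b_{2l-1})\,C_{II}(b_{2l})\,C_I(\aleph_0)$, alternating the codes starting with $C_I$, and set $?_V^{-1}(v)=[b_1,\dots,b_{2l}]$. $\hat{?}^{-1}\colon A^*\to\mathbb{Q}^+$: $\hat{?}^{-1}(\varepsilon)=1$, $\hat{?}^{-1}(0v)=?_V^{-1}(v)$, $\hat{?}^{-1}(1v)=\big(?_V^{-1}(\overline v)\big)^{-1}$. $\hat{\hat{?}}^{-1}\colon A^*\to\mathbb{Q}$: $\hat{\hat{?}}^{-1}(\varepsilon)=0$, $\hat{\hat{?}}^{-1}(0v)=-\hat{?}^{-1}(\overline v)$, $\hat{\hat{?}}^{-1}(1v)=\hat{?}^{-1}(v)$. The sequences $V_{10},V_1,V$ list the values $?_V^{-1}(v)$, $\hat{?}^{-1}(v)$, $\hat{\hat{?}}^{-1}(v)$ respectively, for $v\in A^*$ ordered by the integer $n=(1v)_2$ (the binary number with digits $1v$), $n=1,2,3,\dots$. *)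

theory Defs
  imports Complex_Main "HOL-Library.Stream" "HOL-Library.Discrete_Functions"
begin

text \<open>
  The alphabet \<open>{0, 1}\<close> is \<^typ>\<open>bool\<close> with \<open>1\<close> represented by \<^const>\<open>True\<close>, so finite words
  are of type \<^typ>\<open>bool list\<close> and infinite words of type \<^typ>\<open>bool stream\<close>.
  The positive integers are the \<^typ>\<open>nat\<close> values \<open>\<ge> 1\<close>.
\<close>

type_synonym word = "bool list"

definition compl_word :: "word \<Rightarrow> word" where
  "compl_word w = map Not w"

text \<open>For \<open>b \<ge> 1\<close>, \<^term>\<open>floor_log b\<close> is the floor of the binary logarithm of \<open>b\<close>.\<close>

definition code_I :: "nat \<Rightarrow> word" where
  "code_I b = (let l = floor_log b in
     replicate l False @ [True] @ map (\<lambda>k. \<not> bit b k) (rev [0..<l]))"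

definition code_II :: "nat \<Rightarrow> word" where
  "code_II b = compl_word (code_I b)"

definition code_I_aleph0 :: "bool stream" where
  "code_I_aleph0 = sconst False"

fun alternate :: "('a \<Rightarrow> 'b list) \<Rightarrow> ('a \<Rightarrow> 'b list) \<Rightarrow> 'a list \<Rightarrow> 'b list" where
  "alternate C D [] = []"
| "alternate C D (b # bs) = C b @ alternate D C bs"

text \<open>The continued fraction \<open>[b\<^sub>1, \<dots>, b\<^sub>m] = 1 / (b\<^sub>1 + 1 / (b\<^sub>2 + \<dots>))\<close>.\<close>

fun cfrac :: "nat list \<Rightarrow> rat" where
  "cfrac [] = 0"
| "cfrac (b # bs) = 1 / (of_nat b + cfrac bs)"

text \<open>The list \<open>bs\<close> of even length decomposes the infinite word \<open>v 1 0\<^sup>\<omega>\<close>.\<close>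

definition decomposes :: "word \<Rightarrow> nat list \<Rightarrow> bool" where
  "decomposes v bs \<longleftrightarrow>
     even (length bs) \<and> (\<forall>b\<in>set bs. b \<ge> 1) \<and>
     v @- True ## sconst False = alternate code_I code_II bs @- code_I_aleph0"

definition qV_inv :: "word \<Rightarrow> rat" where
  "qV_inv v = cfrac (THE bs. decomposes v bs)"

fun qhat_inv :: "word \<Rightarrow> rat" where
  "qhat_inv [] = 1"
| "qhat_inv (False # v) = qV_inv v"
| "qhat_inv (True # v) = inverse (qV_inv (compl_word v))"

fun qhathat_inv :: "word \<Rightarrow> rat" where
  "qhathat_inv [] = 0"
| "qhathat_inv (False # v) = - qhat_inv (compl_word v)"
| "qhathat_inv (True # v) = qhat_inv v"

text \<open>
  The integer \<open>(1v)\<^sub>2\<close>; \<^const>\<open>horner_sum\<close> expects the least significant digit first.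
\<close>

definition word_index :: "word \<Rightarrow> nat" where
  "word_index v = horner_sum of_bool 2 (rev (True # v))"

definition nth_word :: "nat \<Rightarrow> word" where
  "nth_word n = (THE v. word_index v = n)"

text \<open>The three sequences are indexed by \<open>n \<ge> 1\<close>; their values at \<open>0\<close> are irrelevant.\<close>

definition V10 :: "nat \<Rightarrow> rat" where
  "V10 n = qV_inv (nth_word n)"

definition V1 :: "nat \<Rightarrow> rat" where
  "V1 n = qhat_inv (nth_word n)"

definition V :: "nat \<Rightarrow> rat" where
  "V n = qhathat_inv (nth_word n)"

end

theory Submission
  imports Defs
begin

text \<open>
  The word \<open>0\<^sup>l 1 w\<close> with \<open>w\<close> of length \<open>l\<close> is the code of the integer with binary digits \<open>1\<close>
  followed by the complement of \<open>w\<close>. Hence any infinite word containing a \<open>1\<close> has exactly one code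
  word \<open>C\<^sub>I(b)\<close> as a prefix, and dually for \<open>C\<^sub>I\<^sub>I\<close>. Stripping off pairs \<open>C\<^sub>I(b) C\<^sub>I\<^sub>I(c)\<close>
  therefore identifies the infinite words with finitely many ones with the lists of positive integers
  of even length, \<open>0\<^sup>\<omega>\<close> corresponding to the empty list. On the arithmetical side
  \<open>r = 1 / (b + 1 / (c + x))\<close> with \<open>0 \<le> x < 1\<close> determines \<open>b = \<lceil>1/r\<rceil> - 1\<close> and then
  \<open>c = \<lfloor>1 / (1/r - b)\<rfloor>\<close>, and this variant of the Euclidean algorithm terminates at \<open>x = 0\<close>.
\<close>

section \<open>Numbering of the finite words by the positive integers\<close>

lemma word_index_Nil [simp]: "word_index [] = 1"
  by (simp add: word_index_def)

lemma word_index_snoc [simp]: "word_index (v @ [b]) = of_bool b + 2 * word_index v"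
  by (simp add: word_index_def)

lemma word_index_pos: "word_index v \<ge> 1"
  by (induction v rule: rev_induct) auto

text \<open>The last letter is the parity of the index, and halving the index removes that
  letter.\<close>

lemma inj_word_index: "inj word_index"
proof (rule injI)
  show "v = w" if "word_index v = word_index w" for v w
    using that
  proof (induction v arbitrary: w rule: rev_induct)
    case Nil
    show ?case
    proof (cases w rule: rev_cases)
      case (snoc w' b)
      with Nil word_index_pos[of w'] show ?thesis by simp
    qed simp
  next
    case (snoc a v)
    show ?case
    proof (cases w rule: rev_cases)
      case Nil
      with snoc word_index_pos[of v] show ?thesis by simp
    next
      case (snoc w' b)
      with snoc.prems have eq: "of_bool a + 2 * word_index v = of_bool b + 2 * word_index w'"
        by simp
      then have "a = b" by (cases a; cases b; simp; presburger)
      with eq snoc.IH[of w'] snoc show ?thesis by simp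
    qed
  qed
qed

lemma ex_word_index:
  assumes "n \<ge> 1"
  shows "\<exists>v. word_index v = n"
  using assms
proof (induction n rule: less_induct)
  case (less n)
  show ?case
  proof (cases "n = 1")
    case True
    then show ?thesis by (intro exI[of _ "[]"]) simp
  next
    case False
    with less.prems have "n div 2 < n" "n div 2 \<ge> 1" by auto
    with less.IH obtain v where "word_index v = n div 2" by blast
    then have "word_index (v @ [odd n]) = n" by (simp add: odd_two_times_div_two_succ)
    then show ?thesis ..
  qed
qed

lemma nth_word_index [simp]: "nth_word (word_index v) = v"
  unfolding nth_word_def using inj_word_index by (auto simp: inj_eq)

lemma word_index_nth_word: "n \<ge> 1 \<Longrightarrow> word_index (nth_word n) = n"
  using ex_word_index by fastforce

text \<open>Passes from bijectivity on words to "exactly once" in the sequence. Since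
  \<open>word_index\<close> takes all positive values and never 0, the bound on \<open>n\<close>
  excludes only the unspecified value \<open>nth_word 0\<close>.\<close>

lemma ex1_nth_word:
  assumes "bij_betw f UNIV S" and "x \<in> S"
  shows "\<exists>!n. n \<ge> 1 \<and> f (nth_word n) = x"
proof -
  from assms obtain v where v: "f v = x" by (auto simp: bij_betw_def)
  show ?thesis
  proof (rule ex1I[of _ "word_index v"])
    fix n assume n: "n \<ge> 1 \<and> f (nth_word n) = x"
    with v assms have "nth_word n = v" by (auto simp: bij_betw_def inj_eq)
    with n show "n = word_index v" using word_index_nth_word by auto
  qed (use v word_index_pos in auto)
qed

lemma floor_log_word_index: "floor_log (word_index v) = length v"
proof (induction v rule: rev_induct)
  case (snoc b v)
  have "floor_log (word_index (v @ [b])) = Suc (floor_log (word_index (v @ [b]) div 2))"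
    using word_index_pos[of v] by (intro floor_log_rec) simp
  with snoc show ?case by simp
qed simp

section \<open>The two codes: unique and complete decoding of a prefix\<close>

lemma compl_compl_word [simp]: "compl_word (compl_word v) = v"
  by (simp add: compl_word_def comp_def)

lemma length_compl_word [simp]: "length (compl_word v) = length v"
  by (simp add: compl_word_def)

lemma compl_word_inj [simp]: "compl_word v = compl_word w \<longleftrightarrow> v = w"
  by (metis compl_compl_word)

text \<open>Every \<open>b \<ge> 1\<close> is some \<open>word_index v\<close>, so this form frees
  all later decoding arguments from binary arithmetic.\<close>

lemma code_I_word_index:
  "code_I (word_index v) = replicate (length v) False @ True # compl_word v"
proof -
  \<comment> \<open>The reversal in \<open>word_index\<close> and the one in \<open>code_I\<close>
    cancel; the leading 1 sits at bit \<open>length v\<close>, outside the range.\<close>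
  have "map (\<lambda>k. \<not> bit (word_index v) k) (rev [0..<length v]) = map Not v"
    by (rule nth_equalityI)
      (auto simp: rev_nth word_index_def bit_horner_sum_bit_iff nth_append)
  then show ?thesis
    by (simp add: code_I_def floor_log_word_index compl_word_def)
qed

lemma code_I_compl_word_index:
  "code_I (word_index (compl_word v)) = replicate (length v) False @ True # v"
  by (simp add: code_I_word_index)

lemma True_in_code_I: "True \<in> set (code_I b)"
  by (simp add: code_I_def Let_def)

lemma zeros_one_shift_inj:
  assumes "replicate l False @- True ## s = replicate m False @- True ## t"
  shows "l = m \<and> s = t"
  using assms
proof (induction l arbitrary: m)
  case 0
  then show ?case by (cases m) auto
next
  case (Suc l)
  then show ?case by (cases m) auto
qed

lemma shift_inj_same_length:
  assumes "u @- s = v @- t" and "length u = length v"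
  shows "u = v \<and> s = t"
  using assms(2,1) by (induction u v rule: list_induct2) auto

text \<open>The number of leading zeros tells how many letters follow the first 1 in the code word,
  and those letters determine the integer.\<close>

lemma code_I_shift_inj:
  assumes "code_I b @- s = code_I c @- t" and "b \<ge> 1" and "c \<ge> 1"
  shows "b = c \<and> s = t"
proof -
  obtain v w where vw: "b = word_index v" "c = word_index w"
    using ex_word_index assms(2,3) by metis
  with assms(1)
  have "replicate (length v) False @- True ## (compl_word v @- s) =
        replicate (length w) False @- True ## (compl_word w @- t)"
    by (simp add: code_I_word_index)
  from zeros_one_shift_inj[OF this]
  have "length v = length w" "compl_word v @- s = compl_word w @- t" by auto
  with shift_inj_same_length[of "compl_word v" s "compl_word w" t] vw show ?thesis
    by auto
qed

text \<open>Letterwise complement exchanges the two codes, so facts about \<open>code_II\<close>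
  follow from those about \<open>code_I\<close>.\<close>

lemma smap_Not_code_II_shift: "smap Not (code_II b @- s) = code_I b @- smap Not s"
  by (simp add: code_II_def compl_word_def comp_def)

lemma code_II_shift_inj:
  assumes "code_II b @- s = code_II c @- t" and "b \<ge> 1" and "c \<ge> 1"
  shows "b = c \<and> s = t"
proof -
  have "code_I b @- smap Not s = code_I c @- smap Not t"
    using assms(1) smap_Not_code_II_shift by metis
  from this assms(2,3) have *: "b = c \<and> smap Not s = smap Not t" by (rule code_I_shift_inj)
  moreover have "inj (smap Not)" by (intro stream.inj_map injI) simp
  ultimately show ?thesis by (simp add: inj_eq)
qed

lemma ex_code_I_prefix:
  assumes "True \<in> sset s"
  shows "\<exists>b t. b \<ge> 1 \<and> s = code_I b @- t"
proof -
  from assms obtain n where "s !! n" by (auto simp: sset_range)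
  \<comment> \<open>\<open>l\<close> counts the zeros before the first 1; the next \<open>l\<close>
    letters after that 1 complete the code word.\<close>
  define l where "l = (LEAST n. s !! n)"
  have "s !! l" unfolding l_def using \<open>s !! n\<close> by (rule LeastI)
  moreover have "stake l s = replicate l False"
    by (rule nth_equalityI) (auto simp: l_def dest: not_less_Least)
  ultimately have "s = replicate l False @- True ## sdrop (Suc l) s"
    using id_stake_snth_sdrop[of s l] by simp
  then obtain r where s: "s = replicate l False @- True ## r" by blast
  define w where "w = stake l r"
  have "s = code_I (word_index (compl_word w)) @- sdrop l r"
    by (simp add: s code_I_compl_word_index w_def stake_sdrop)
  then show ?thesis using word_index_pos by blast
qed

lemma ex_code_II_prefix:
  assumes "False \<in> sset s"
  shows "\<exists>b t. b \<ge> 1 \<and> s = code_II b @- t"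
proof -
  have "True \<in> sset (smap Not s)" using assms by (force simp: stream.set_map)
  then obtain b t where b: "b \<ge> 1" and "smap Not s = code_I b @- t"
    using ex_code_I_prefix by blast
  then have "smap Not (smap Not s) = smap Not (code_I b @- t)" by simp
  then have "s = code_II b @- smap Not t"
    by (simp add: stream.map_comp comp_def stream.map_ident code_II_def compl_word_def)
  with b show ?thesis by blast
qed

section \<open>Infinite words with finitely many ones and lists of even length\<close>

definition even_lists :: "nat list set" where
  "even_lists = {bs. even (length bs) \<and> (\<forall>b\<in>set bs. b \<ge> 1)}"

text \<open>The empty list stands for the all-zero word and for the fraction 0. It is the base case
  when pairs of entries are stripped off, although no word \<open>v\<close> has it as its
  decomposition.\<close>

lemma Nil_in_even_lists [simp]: "[] \<in> even_lists"
  by (simp add: even_lists_def)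

lemma even_lists_Cons_Cons [simp]:
  "b # c # bs \<in> even_lists \<longleftrightarrow> b \<ge> 1 \<and> c \<ge> 1 \<and> bs \<in> even_lists"
  by (auto simp: even_lists_def)

lemma even_lists_induct [consumes 1, case_names Nil Cons_Cons]:
  assumes "bs \<in> even_lists" and "P []"
    and "\<And>b c bs. b \<ge> 1 \<Longrightarrow> c \<ge> 1 \<Longrightarrow> bs \<in> even_lists \<Longrightarrow> P bs \<Longrightarrow> P (b # c # bs)"
  shows "P bs"
  using assms(1)
  by (induction bs rule: induct_list012) (use assms in \<open>auto simp: even_lists_def\<close>)

lemma even_lists_cases [consumes 1, case_names Nil Cons_Cons]:
  assumes "bs \<in> even_lists"
  obtains "bs = []"
  | b c cs where "bs = b # c # cs" "b \<ge> 1" "c \<ge> 1" "cs \<in> even_lists"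
  using assms by (induction rule: even_lists_induct) auto

lemma code_I_aleph0_unfold: "code_I_aleph0 = False ## code_I_aleph0"
  unfolding code_I_aleph0_def by (metis siterate.code id_apply)

lemma sset_code_I_aleph0 [simp]: "sset code_I_aleph0 = {False}"
  by (simp add: code_I_aleph0_def)

lemma sdrop_code_I_aleph0 [simp]: "sdrop n code_I_aleph0 = code_I_aleph0"
  by (induction n) (simp, metis code_I_aleph0_unfold sdrop.simps(2) stream.sel(2))

lemma zeros_shift_zeros: "True \<notin> set u \<Longrightarrow> u @- code_I_aleph0 = code_I_aleph0"
  by (induction u) (auto simp flip: code_I_aleph0_unfold)

lemma shift_one_neq_zeros: "u @- True ## s \<noteq> code_I_aleph0"
proof
  assume eq: "u @- True ## s = code_I_aleph0"
  have "True \<in> sset (u @- True ## s)" by simp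
  then show False unfolding eq by simp
qed

lemma decomposes_iff:
  "decomposes v bs \<longleftrightarrow> bs \<in> even_lists \<and>
     v @- True ## code_I_aleph0 = alternate code_I code_II bs @- code_I_aleph0"
  by (simp add: decomposes_def even_lists_def flip: code_I_aleph0_def)

lemma code_I_shift_neq_zeros: "code_I b @- s \<noteq> code_I_aleph0"
proof
  assume "code_I b @- s = code_I_aleph0"
  then have "set (code_I b) \<subseteq> sset (code_I_aleph0)" by (metis Un_upper1 sset_shift)
  with True_in_code_I[of b] show False by auto
qed

text \<open>Both lists lose one pair of code words at a time. An empty list cannot match a nonempty
  one, because each \<open>code_I\<close> word contains a 1.\<close>

lemma alternate_codes_inj:
  assumes "bs \<in> even_lists" "cs \<in> even_lists"
    and "alternate code_I code_II bs @- code_I_aleph0 = alternate code_I code_II cs @- code_I_aleph0"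
  shows "bs = cs"
  using assms
proof (induction bs arbitrary: cs rule: even_lists_induct)
  case Nil
  from Nil(1) show ?case
  proof (cases rule: even_lists_cases)
    case (Cons_Cons b c ds)
    with Nil show ?thesis
      using code_I_shift_neq_zeros[of b] by (metis alternate.simps shift.simps(1) shift_append)
  qed simp
next
  case (Cons_Cons b c bs)
  from Cons_Cons.prems(1) show ?case
  proof (cases rule: even_lists_cases)
    case Nil
    with Cons_Cons.prems show ?thesis
      using code_I_shift_neq_zeros[of b] by (metis alternate.simps shift.simps(1) shift_append)
  next
    case (Cons_Cons d e ds)
    with Cons_Cons.prems(2)
    have "code_I b @- code_II c @- alternate code_I code_II bs @- code_I_aleph0 =
          code_I d @- code_II e @- alternate code_I code_II ds @- code_I_aleph0"
      by simp
    from code_I_shift_inj[OF this] \<open>b \<ge> 1\<close> Cons_Cons(2)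
    have bd: "b = d"
      and "code_II c @- alternate code_I code_II bs @- code_I_aleph0 =
        code_II e @- alternate code_I code_II ds @- code_I_aleph0" by auto
    from code_II_shift_inj[OF this(2)] \<open>c \<ge> 1\<close> Cons_Cons(3)
    have "c = e" "alternate code_I code_II bs @- code_I_aleph0 =
        alternate code_I code_II ds @- code_I_aleph0" by auto
    with bd Cons_Cons.IH[of ds] Cons_Cons show ?thesis by simp
  qed
qed

text \<open>An arbitrary finite part \<open>u\<close> is allowed, instead of one ending in 1, so
  that the remainder after two code words has the same shape with a shorter finite part.\<close>

lemma ex_alternate_codes:
  "\<exists>bs\<in>even_lists. u @- code_I_aleph0 = alternate code_I code_II bs @- code_I_aleph0"
proof (induction u rule: length_induct)
  case (1 u)
  show ?case
  proof (cases "True \<in> set u")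
    case False
    then show ?thesis by (intro bexI[of _ "[]"]) (auto simp: zeros_shift_zeros)
  next
    case True
    then have "True \<in> sset (u @- code_I_aleph0)" by simp
    then obtain b s where b: "b \<ge> 1" "u @- code_I_aleph0 = code_I b @- s"
      using ex_code_I_prefix by blast
    let ?k = "length (code_I b)"
    have "s = sdrop ?k (u @- code_I_aleph0)" using b by (simp add: sdrop_shift)
    \<comment> \<open>The code word may run past the end of \<open>u\<close> into the zeros; then
      \<open>drop\<close> yields the empty word and the tail is still all zeros.\<close>
    then have s: "s = drop ?k u @- code_I_aleph0" by (simp add: sdrop_shift)
    \<comment> \<open>The zeros at the end guarantee that a \<open>code_II\<close> prefix
      exists.\<close>
    then have "False \<in> sset s" by simp
    then obtain c t where c: "c \<ge> 1" "s = code_II c @- t"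
      using ex_code_II_prefix by blast
    let ?m = "length (code_II c)"
    have "t = sdrop ?m s" using c by (simp add: sdrop_shift)
    then have t: "t = drop ?m (drop ?k u) @- code_I_aleph0"
      by (simp add: s sdrop_shift del: drop_drop)
    have "?k > 0" using True_in_code_I[of b] by (metis length_pos_if_in_set)
    moreover have "length u > 0" using True by (metis length_pos_if_in_set)
    ultimately have "length (drop ?m (drop ?k u)) < length u" by simp
    with 1 obtain bs where "bs \<in> even_lists"
      "t = alternate code_I code_II bs @- code_I_aleph0" unfolding t by blast
    with b c show ?thesis by (intro bexI[of _ "b # c # bs"]) auto
  qed
qed

text \<open>The appended 1 is the last 1 of the infinite word and marks where \<open>v\<close> ends,
  so trailing zeros of \<open>v\<close> are not lost.\<close>

lemma shift_one_zeros_inj: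
  assumes "v @- True ## code_I_aleph0 = w @- True ## code_I_aleph0"
  shows "v = w"
  using assms
proof (induction v arbitrary: w)
  case Nil
  then show ?case using shift_one_neq_zeros by (cases w) (auto, metis)
next
  case (Cons a v)
  then show ?case using shift_one_neq_zeros by (cases w) auto
qed

lemma ex1_decomposes: "\<exists>!bs. decomposes v bs"
proof -
  obtain bs where "bs \<in> even_lists"
    "(v @ [True]) @- code_I_aleph0 = alternate code_I code_II bs @- code_I_aleph0"
    using ex_alternate_codes by blast
  then have bs: "decomposes v bs"
    by (simp add: decomposes_iff)
  then show ?thesis
  proof (rule ex1I)
    fix cs assume "decomposes v cs"
    with bs show "cs = bs"
      by (intro alternate_codes_inj) (auto simp: decomposes_iff)
  qed
qed

lemma ex_decomposes:
  assumes "bs \<in> even_lists" "bs \<noteq> []"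
  shows "\<exists>v. decomposes v bs"
proof -
  from assms have "True \<in> set (alternate code_I code_II bs)"
    by (cases bs) (auto simp: True_in_code_I)
  \<comment> \<open>Cutting at the last 1 of the concatenated code words gives \<open>v\<close>; the
    zeros in \<open>z\<close> merge with the infinite tail.\<close>
  then obtain v z where v: "alternate code_I code_II bs = v @ True # z" "True \<notin> set z"
    using split_list_last by metis
  then have "alternate code_I code_II bs @- code_I_aleph0 = v @- True ## code_I_aleph0"
    by (simp add: zeros_shift_zeros)
  with assms show ?thesis
    by (auto simp: decomposes_iff)
qed

lemma decomposes_imp_even_list:
  assumes "decomposes v bs"
  shows "bs \<in> even_lists - {[]}"
proof -
  have "bs \<noteq> []"
  proof
    assume "bs = []"
    with assms show False by (simp add: decomposes_iff shift_one_neq_zeros)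
  qed
  with assms show ?thesis by (simp add: decomposes_iff)
qed

lemma bij_betw_decomposition:
  "bij_betw (\<lambda>v. THE bs. decomposes v bs) UNIV (even_lists - {[]})"
proof (rule bij_betwI')
  fix v w
  have v: "decomposes v (THE bs. decomposes v bs)" and w: "decomposes w (THE bs. decomposes w bs)"
    using ex1_decomposes by (metis theI')+
  show "(THE bs. decomposes v bs) = (THE bs. decomposes w bs) \<longleftrightarrow> v = w"
  proof
    assume "(THE bs. decomposes v bs) = (THE bs. decomposes w bs)"
    with v w show "v = w" by (intro shift_one_zeros_inj) (simp add: decomposes_iff)
  qed simp
  from v show "(THE bs. decomposes v bs) \<in> even_lists - {[]}" by (rule decomposes_imp_even_list)
next
  fix bs assume "bs \<in> even_lists - {[]}"
  then obtain v where "decomposes v bs" using ex_decomposes by auto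
  then have "bs = (THE bs. decomposes v bs)" using ex1_decomposes by (metis the1_equality)
  then show "\<exists>v\<in>UNIV. bs = (THE bs. decomposes v bs)" by blast
qed

section \<open>Continued fractions of even length\<close>

lemma cfrac_Cons_bounds:
  assumes "c \<ge> 1" "0 \<le> cfrac bs"
  shows "0 < cfrac (c # bs)" "cfrac (c # bs) \<le> 1"
proof -
  have "(1 :: rat) \<le> of_nat c" using assms(1) by simp
  with assms(2) have "1 \<le> of_nat c + cfrac bs" by linarith
  then show "0 < cfrac (c # bs)" "cfrac (c # bs) \<le> 1" by auto
qed

lemma cfrac_even_bounds: "bs \<in> even_lists \<Longrightarrow> 0 \<le> cfrac bs \<and> cfrac bs < 1"
proof (induction rule: even_lists_induct)
  case (Cons_Cons b c bs)
  have "(1 :: rat) \<le> of_nat b" using Cons_Cons(1) by simp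
  moreover have "0 < cfrac (c # bs)" using Cons_Cons by (intro cfrac_Cons_bounds) auto
  ultimately have "1 < of_nat b + cfrac (c # bs)" by linarith
  then show ?case unfolding cfrac.simps(2)[of b] by simp
qed simp

lemma cfrac_even_pos:
  assumes "bs \<in> even_lists" "bs \<noteq> []"
  shows "0 < cfrac bs"
  using assms(1)
proof (cases rule: even_lists_cases)
  case (Cons_Cons b c cs)
  then have "0 < cfrac (c # cs)" using cfrac_even_bounds by (intro cfrac_Cons_bounds) auto
  with Cons_Cons show ?thesis using cfrac_Cons_bounds(1)[of b "c # cs"] by simp
qed (use assms in simp)

text \<open>A tail of odd length lies in (0,1], with value 1 for the list \<open>[1]\<close>, while
  a tail of even length lies in [0,1). Hence the first entry of a pair is recovered by a ceiling and
  the second by a floor, and fixing the parity removes the usual ambiguity of the last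
  entry.\<close>

lemma cfrac_tail_bounds:
  assumes "c \<ge> 1" "bs \<in> even_lists"
  shows "0 < cfrac (c # bs)" "cfrac (c # bs) \<le> 1"
  using assms cfrac_even_bounds cfrac_Cons_bounds by blast+

lemma cfrac_even_inj:
  assumes "bs \<in> even_lists" "cs \<in> even_lists" "cfrac bs = cfrac cs"
  shows "bs = cs"
  using assms
proof (induction bs arbitrary: cs rule: even_lists_induct)
  case Nil
  then show ?case using cfrac_even_pos[of cs] by fastforce
next
  case (Cons_Cons b c bs)
  from Cons_Cons.prems(1) show ?case
  proof (cases rule: even_lists_cases)
    case Nil
    then show ?thesis using Cons_Cons cfrac_even_pos[of "b # c # bs"] by auto
  next
    case (Cons_Cons d e ds)
    note IH = Cons_Cons.IH and hyps = Cons_Cons.hyps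
    have eq: "of_nat b + cfrac (c # bs) = of_nat d + cfrac (e # ds)"
      using Cons_Cons.prems(2) Cons_Cons(1)
      by (simp only: cfrac.simps(2)[of b] cfrac.simps(2)[of d] divide_eq_eq_1 divide_cancel_left) simp
    have "\<lceil>of_nat b + cfrac (c # bs)\<rceil> = int b + 1"
      using cfrac_tail_bounds[OF hyps(2,3)] by (intro ceiling_unique) auto
    moreover have "\<lceil>of_nat d + cfrac (e # ds)\<rceil> = int d + 1"
      using cfrac_tail_bounds[OF Cons_Cons(3,4)] by (intro ceiling_unique) auto
    ultimately have bd: "b = d" using eq by simp
    with eq have eq': "of_nat c + cfrac bs = of_nat e + cfrac ds" by simp
    have "\<lfloor>of_nat c + cfrac bs\<rfloor> = int c"
      using cfrac_even_bounds[OF hyps(3)] by (intro floor_unique) auto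
    moreover have "\<lfloor>of_nat e + cfrac ds\<rfloor> = int e"
      using cfrac_even_bounds[OF Cons_Cons(4)] by (intro floor_unique) auto
    ultimately have "c = e" using eq' by simp
    with eq' bd IH[of ds] Cons_Cons show ?thesis by simp
  qed
qed

text \<open>One round of the Euclidean algorithm replaces the pair \<open>p\<close>,
  \<open>q\<close> by \<open>p''\<close>, \<open>p'\<close>, whose second member is smaller than
  \<open>q\<close>. Neither lowest terms nor \<open>p > 0\<close> is assumed, so the remainders can
  be fed back directly.\<close>

lemma ex_cfrac_even:
  assumes "p < q"
  shows "\<exists>bs\<in>even_lists. cfrac bs = of_nat p / of_nat q"
  using assms
proof (induction q arbitrary: p rule: less_induct)
  case (less q)
  show ?case
  proof (cases "p = 0")
    case True
    then show ?thesis by (intro bexI[of _ "[]"]) auto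
  next
    case False
    \<comment> \<open>Shifting by one puts the remainder \<open>p'\<close> in the range 1 to
      \<open>p\<close> instead of 0 to \<open>p - 1\<close>, as the odd tail \<open>p' / p\<close>
      must lie in (0,1].\<close>
    define b p' where "b = (q - 1) div p" and "p' = (q - 1) mod p + 1"
    have p': "0 < p'" "p' \<le> p" using False by (auto simp: p'_def Suc_leI)
    have "p * b + p' = (q - 1) + 1" unfolding b_def p'_def by (metis add.assoc mult_div_mod_eq)
    with less.prems have q: "q = p * b + p'" by simp
    have b: "b \<ge> 1" using less.prems False by (simp add: b_def Suc_le_eq div_greater_zero_iff)
    define c p'' where "c = p div p'" and "p'' = p mod p'"
    have p: "p = p' * c + p''" by (simp add: c_def p''_def)
    have c: "c \<ge> 1" using p' by (simp add: c_def Suc_le_eq div_greater_zero_iff)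
    have "p'' < p'" using p' by (simp add: p''_def)
    moreover have "p' < q" using p' less.prems by simp
    ultimately obtain bs where bs: "bs \<in> even_lists" "cfrac bs = of_nat p'' / of_nat p'"
      using less.IH by blast
    have "of_nat c + cfrac bs = of_nat p / of_nat p'"
      using p' bs by (subst p) (simp add: field_simps)
    then have "cfrac (c # bs) = of_nat p' / of_nat p" by simp
    moreover have "of_nat b + of_nat p' / of_nat p = (of_nat q / of_nat p :: rat)"
      using False by (subst q) (simp add: field_simps)
    ultimately have "cfrac (b # c # bs) = of_nat p / of_nat q"
      by (simp only: cfrac.simps(2)[of b]) simp
    with b c bs show ?thesis by (intro bexI[of _ "b # c # bs"]) auto
  qed
qed

lemma bij_betw_cfrac: "bij_betw cfrac (even_lists - {[]}) {x. 0 < x \<and> x < 1}"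
proof (rule bij_betwI')
  fix x :: rat assume x: "x \<in> {x. 0 < x \<and> x < 1}"
  obtain a b where ab: "x = of_int a / of_int b" "b > 0"
    by (metis quotient_of_div quotient_of_denom_pos surj_pair)
  with x have "0 < a" "a < b" by (auto simp: zero_less_divide_iff)
  with ab have "x = of_nat (nat a) / of_nat (nat b)" "nat a < nat b" by auto
  then obtain bs where "bs \<in> even_lists" "cfrac bs = x" using ex_cfrac_even by metis
  with x show "\<exists>bs\<in>even_lists - {[]}. x = cfrac bs" by force
qed (use cfrac_even_inj cfrac_even_pos cfrac_even_bounds in auto)

section \<open>The three bijections\<close>

lemma bij_betw_qV_inv: "bij_betw qV_inv UNIV {x. 0 < x \<and> x < 1}"
  using bij_betw_trans[OF bij_betw_decomposition bij_betw_cfrac]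
  by (simp add: qV_inv_def[abs_def] comp_def)

lemma qV_inv_bounds: "0 < qV_inv v" "qV_inv v < 1"
  using bij_betw_qV_inv by (auto simp: bij_betw_def)

lemma qV_inv_inj [simp]: "qV_inv v = qV_inv w \<longleftrightarrow> v = w"
  using bij_betw_qV_inv by (auto simp: bij_betw_def inj_eq)

lemma ex_qV_inv: "0 < x \<Longrightarrow> x < 1 \<Longrightarrow> \<exists>v. qV_inv v = x"
  using bij_betw_imp_surj_on[OF bij_betw_qV_inv] by (metis (mono_tags, lifting) imageE mem_Collect_eq)

lemma one_less_inverse_qV_inv: "1 < inverse (qV_inv v)"
  using qV_inv_bounds by (simp add: one_less_inverse)

text \<open>The empty word gives 1, words starting with 0 fill (0,1), and words starting with 1 fill
  the numbers above 1 by inversion. These ranges are disjoint, and complementing words is an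
  involution.\<close>

lemma bij_betw_qhat_inv: "bij_betw qhat_inv UNIV {x. 0 < x}"
proof (rule bij_betwI')
  fix v w
  show "qhat_inv v = qhat_inv w \<longleftrightarrow> v = w"
    using qV_inv_bounds one_less_inverse_qV_inv
    by (cases v rule: qhat_inv.cases; cases w rule: qhat_inv.cases)
      (auto, (metis less_irrefl less_trans)+)
  show "qhat_inv v \<in> {x. 0 < x}"
    by (cases v rule: qhat_inv.cases) (auto simp: qV_inv_bounds)
next
  fix x :: rat assume x: "x \<in> {x. 0 < x}"
  consider "x = 1" | "x < 1" | "x > 1" by linarith
  then show "\<exists>v\<in>UNIV. x = qhat_inv v"
  proof cases
    case 1
    then show ?thesis by (intro bexI[of _ "[]"]) auto
  next
    case 2
    with x obtain v where "qV_inv v = x" using ex_qV_inv by blast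
    then show ?thesis by (intro bexI[of _ "False # v"]) auto
  next
    case 3
    then have "0 < inverse x" "inverse x < 1" by (auto simp: inverse_less_1_iff)
    then obtain v where "qV_inv v = inverse x" using ex_qV_inv by blast
    then show ?thesis by (intro bexI[of _ "True # compl_word v"]) auto
  qed
qed

lemma qhat_inv_pos: "0 < qhat_inv v"
  using bij_betw_qhat_inv by (auto simp: bij_betw_def)

lemma qhat_inv_inj [simp]: "qhat_inv v = qhat_inv w \<longleftrightarrow> v = w"
  using bij_betw_qhat_inv by (auto simp: bij_betw_def inj_eq)

lemma ex_qhat_inv: "0 < x \<Longrightarrow> \<exists>v. qhat_inv v = x"
  using bij_betw_imp_surj_on[OF bij_betw_qhat_inv] by (metis (mono_tags, lifting) imageE mem_Collect_eq)

text \<open>The same three-way split, now at 0: the first letter determines the sign.\<close>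

lemma bij_qhathat_inv: "bij qhathat_inv"
proof (rule bij_betwI')
  fix v w
  have neq: "- qhat_inv v \<noteq> qhat_inv w" "qhat_inv v \<noteq> - qhat_inv w"
    "qhat_inv v \<noteq> 0" "0 \<noteq> qhat_inv v" for v w
    using qhat_inv_pos[of v] qhat_inv_pos[of w] by linarith+
  show "qhathat_inv v = qhathat_inv w \<longleftrightarrow> v = w"
    by (cases v rule: qhathat_inv.cases; cases w rule: qhathat_inv.cases) (auto simp: neq)
next
  fix x :: rat
  consider "x = 0" | "x < 0" | "x > 0" by linarith
  then show "\<exists>v\<in>UNIV. x = qhathat_inv v"
  proof cases
    case 1
    then show ?thesis by (intro bexI[of _ "[]"]) auto
  next
    case 2
    then obtain v where "qhat_inv v = - x" using ex_qhat_inv[of "- x"] by auto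
    then show ?thesis by (intro bexI[of _ "False # compl_word v"]) auto
  next
    case 3
    then obtain v where "qhat_inv v = x" using ex_qhat_inv by blast
    then show ?thesis by (intro bexI[of _ "True # v"]) auto
  qed
qed simp

theorem mainTheorem1:
  shows "(bij_betw qV_inv UNIV {x::rat. 0 < x \<and> x < 1} \<and>
          (\<forall>x::rat. 0 < x \<and> x < 1 \<longrightarrow> (\<exists>!n. n \<ge> 1 \<and> V10 n = x))) \<and>
         (bij_betw qhat_inv UNIV {x::rat. 0 < x} \<and>
          (\<forall>x::rat. 0 < x \<longrightarrow> (\<exists>!n. n \<ge> 1 \<and> V1 n = x))) \<and>
         (bij_betw qhathat_inv UNIV (UNIV :: rat set) \<and>
          (\<forall>x::rat. \<exists>!n. n \<ge> 1 \<and> V n = x))"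
  unfolding V10_def V1_def V_def
  using bij_betw_qV_inv bij_betw_qhat_inv bij_qhathat_inv
    ex1_nth_word[OF bij_betw_qV_inv] ex1_nth_word[OF bij_betw_qhat_inv]
    ex1_nth_word[OF bij_qhathat_inv]
  by (intro conjI allI impI) simp_all

end
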